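(* Let $m$ be a positive integer. Let $Q_m=\{q \text{ prime}: H_m(q)=0\}$ and $S_m=\{n\in\mathbb{N}: q\nmid n \text{ for all } q\in Q_m\}$. Let $T_m$ be the unique set of positive integers determined by: (i) $1\in T_m$; (ii) a prime $p$ lies in $T_m$ if and only if $p-m\in T_m$; (iii) a composite $x$ lies in $T_m$ if and only if there exist $x_1,x_2\in T_m$ with $x_1,x_2>1$ and $x_1x_2=x$. Then $S_m=T_m$.
   Context: For $m,n\in\mathbb{N}$, the Schemmel totient function $L_m(n)$ is the number of integers $k\in\{1,\dots,n\}$ such that $\gcd(k+s,n)=1$ for all $s\in\{0,1,\dots,m-1\}$; by convention $L_m(0)=0$. Equivalently, $L_m(1)=1$, and for $n>1$ with $n=\prod_{i=1}^r p_i^{\alpha_i}$, $L_m(n)=0$ if the smallest prime factor of $n$ is $\le m$, and $L_m(n)=\prod_{i} p_i^{\alpha_i-1}(p_i-m)$ otherwise. Iterates: $f^{(1)}=f$, $f^{(k+1)}=f\circ f^{(k)}$. $R_m(n)$ is the least positive integer $k$ with $L_m^{(k)}(n)\in\{0,1\}$, and $H_m(n)=L_m^{(R_m(n))}(n)$. In (ii), $T_m\subseteq\mathbb{N}$, so $p-m\in T_m$ requires $p-m\ge 1$. *)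

theory Defs
  imports "HOL-Computational_Algebra.Primes"
begin

definition schemmel :: "nat \<Rightarrow> nat \<Rightarrow> nat" where
  "schemmel m n = card {k \<in> {1..n}. \<forall>s<m. gcd (k + s) n = 1}"

text \<open>For \<open>m > 0\<close> the iterates of \<open>schemmel m\<close> strictly decrease until they reach 0 or 1,
  so the following minimum is attained.\<close>

definition R :: "nat \<Rightarrow> nat \<Rightarrow> nat" where
  "R m n = (LEAST k. 0 < k \<and> (schemmel m ^^ k) n \<in> {0, 1})"

definition H :: "nat \<Rightarrow> nat \<Rightarrow> nat" where
  "H m n = (schemmel m ^^ R m n) n"

definition Q :: "nat \<Rightarrow> nat set" where
  "Q m = {q. prime q \<and> H m q = 0}"

text \<open>The natural numbers of the source are the positive integers.\<close>

definition S :: "nat \<Rightarrow> nat set" where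
  "S m = {n. 0 < n \<and> (\<forall>q\<in>Q m. \<not> q dvd n)}"

text \<open>The guard \<open>m < p\<close> says that the integer \<open>p - m\<close> is positive, as membership in a set of
  positive integers requires; with it, truncated subtraction plays no role.\<close>

definition T_conditions :: "nat \<Rightarrow> nat set \<Rightarrow> bool" where
  "T_conditions m A \<longleftrightarrow>
     A \<subseteq> {0<..} \<and>
     1 \<in> A \<and>
     (\<forall>p. prime p \<longrightarrow> (p \<in> A \<longleftrightarrow> m < p \<and> p - m \<in> A)) \<and>
     (\<forall>x. 1 < x \<and> \<not> prime x \<longrightarrow>
        (x \<in> A \<longleftrightarrow> (\<exists>x1\<in>A. \<exists>x2\<in>A. 1 < x1 \<and> 1 < x2 \<and> x1 * x2 = x)))"

definition T :: "nat \<Rightarrow> nat set" where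
  "T m = (THE A. T_conditions m A)"

end

theory Submission
  imports Defs "HOL-Number_Theory.Cong"
begin

text \<open>Let \<open>G\<close> be the set of all \<open>n\<close> some iterate of which is 1.  Since
  \<open>L\<^sub>m(p n)\<close> is \<open>p L\<^sub>m(n)\<close> or \<open>(p - m) L\<^sub>m(n)\<close> according to whether the prime \<open>p\<close> divides
  \<open>n\<close>, strong induction shows that \<open>n \<in> G\<close> if and only if all prime factors of \<open>n\<close> are in \<open>G\<close>,
  that is, \<open>G = S\<^sub>m\<close>. In particular a prime \<open>p\<close> is in \<open>S\<^sub>m\<close> if and only if
  \<open>L\<^sub>m(p) = p - m\<close> is, which is condition (ii); condition (iii) holds because membership in
  \<open>S\<^sub>m\<close> only depends on the prime factors. The conditions determine the set by strong induction.\<close>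

section \<open>Residues that start a run coprime to n\<close>

definition run_coprime :: "nat \<Rightarrow> nat \<Rightarrow> nat \<Rightarrow> bool" where
  "run_coprime m n k \<longleftrightarrow> (\<forall>s<m. coprime (k + s) n)"

lemma run_coprime_cong:
  assumes "[k = l] (mod n)"
  shows "run_coprime m n k \<longleftrightarrow> run_coprime m n l"
proof -
  have "coprime (k + s) n \<longleftrightarrow> coprime (l + s) n" for s
    using assms by (metis cong_add_rcancel_nat cong_imp_coprime cong_sym)
  then show ?thesis
    by (simp add: run_coprime_def)
qed

lemma run_coprime_mod: "run_coprime m n (k mod n) \<longleftrightarrow> run_coprime m n k"
  by (rule run_coprime_cong) simp

lemma run_coprime_mult:
  "run_coprime m (a * b) k \<longleftrightarrow> run_coprime m a k \<and> run_coprime m b k"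
  by (auto simp: run_coprime_def)

text \<open>The run condition depends only on \<open>k\<close> modulo \<open>n\<close>, so the range
  from 1 to \<open>n\<close> may be replaced by the residues 0 to \<open>n - 1\<close>, which suit
  remainder maps.\<close>

lemma schemmel_eq_card_residues: "schemmel m n = card {k. k < n \<and> run_coprime m n k}"
proof -
  \<comment> \<open>Only the endpoint moves: \<open>k = n\<close> on one side corresponds to the
    residue 0 on the other.\<close>
  have run_coprime_self: "run_coprime m k k \<longleftrightarrow> run_coprime m k 0" for k
    by (rule run_coprime_cong) (simp add: cong_def)
  have "bij_betw (\<lambda>k. k mod n) {k \<in> {1..n}. run_coprime m n k} {k. k < n \<and> run_coprime m n k}"
    by (rule bij_betw_byWitness[where f' = "\<lambda>k. if k = 0 then n else k"])
      (auto simp: run_coprime_mod le_less run_coprime_self)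
  then have "card {k \<in> {1..n}. run_coprime m n k} = card {k. k < n \<and> run_coprime m n k}"
    by (rule bij_betw_same_card)
  then show ?thesis
    by (simp add: schemmel_def run_coprime_def coprime_iff_gcd_eq_1)
qed

section \<open>Values and multiplicativity of the Schemmel totient\<close>

lemma schemmel_0 [simp]: "schemmel m 0 = 0"
  by (simp add: schemmel_eq_card_residues)

lemma schemmel_1 [simp]: "schemmel m (Suc 0) = Suc 0"
  by (simp add: schemmel_def)

lemma schemmel_less:
  assumes "0 < m" "1 < n"
  shows "schemmel m n < n"
proof -
  \<comment> \<open>Here \<open>0 < m\<close> enters: the shift \<open>s = 0\<close> is available,
    and gcd(0, n) = n > 1.\<close>
  have "\<not> run_coprime m n 0"
    unfolding run_coprime_def using assms by (auto intro!: exI[of _ 0])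
  then have "{k. k < n \<and> run_coprime m n k} \<subseteq> {1..<n}"
    by (auto simp: Suc_le_eq intro!: gr0I)
  then have "schemmel m n \<le> card {1..<n}"
    unfolding schemmel_eq_card_residues by (intro card_mono) auto
  with assms show ?thesis
    by simp
qed

text \<open>A run starting in 1..p is coprime to p iff it stops before p. If p \<le> m no run does,
  in agreement with truncated subtraction.\<close>

lemma schemmel_prime:
  assumes "prime p"
  shows "schemmel m p = p - m"
proof -
  have "(\<forall>s<m. gcd (k + s) p = 1) \<longleftrightarrow> k + m \<le> p" if "1 \<le> k" "k \<le> p" for k
  proof
    assume "\<forall>s<m. gcd (k + s) p = 1"
    moreover have "gcd (k + (p - k)) p \<noteq> 1"
      using that assms by (auto simp: prime_gt_1_nat)
    ultimately have "\<not> p - k < m"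
      by blast
    with that show "k + m \<le> p"
      by simp
  next
    assume "k + m \<le> p"
    show "\<forall>s<m. gcd (k + s) p = 1"
    proof (intro allI impI)
      fix s assume "s < m"
      with \<open>k + m \<le> p\<close> that have "0 < k + s" "k + s < p"
        by auto
      then have "\<not> p dvd k + s"
        by (simp add: nat_dvd_not_less)
      with assms show "gcd (k + s) p = 1"
        by (metis coprime_iff_gcd_eq_1 coprime_commute prime_imp_coprime)
    qed
  qed
  then have "{k \<in> {1..p}. \<forall>s<m. gcd (k + s) p = 1} = {k \<in> {1..p}. k + m \<le> p}"
    by (intro Collect_cong) (meson atLeastAtMost_iff)
  also have "\<dots> = {1..p - m}"
    by auto
  finally have "{k \<in> {1..p}. \<forall>s<m. gcd (k + s) p = 1} = {1..p - m}" .
  then show ?thesis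
    by (simp add: schemmel_def)
qed

text \<open>Chinese remainder theorem: a run is coprime to \<open>a * b\<close> iff it is coprime to
  both factors, and these conditions see only the two remainders.\<close>

lemma schemmel_mult_coprime:
  assumes "coprime a b"
  shows "schemmel m (a * b) = schemmel m a * schemmel m b"
proof (cases "a = 0 \<or> b = 0")
  case False
  let ?C = "\<lambda>n. {k. k < n \<and> run_coprime m n k}"
  have "bij_betw (\<lambda>x. (x mod a, x mod b)) (?C (a * b)) (?C a \<times> ?C b)"
    unfolding bij_betw_def
  proof
    show "inj_on (\<lambda>x. (x mod a, x mod b)) (?C (a * b))"
    proof (rule inj_onI, clarsimp)
      fix x y assume *: "x < a * b" "y < a * b" "x mod a = y mod a" "x mod b = y mod b"
      then have "[x = y] (mod a * b)"
        using assms by (intro coprime_cong_mult_nat) (simp_all add: cong_def)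
      with * show "x = y"
        by (simp add: cong_def)
    qed
  next
    show "(\<lambda>x. (x mod a, x mod b)) ` ?C (a * b) = ?C a \<times> ?C b"
    proof (intro equalityI subsetI)
      fix z assume "z \<in> ?C a \<times> ?C b"
      then obtain u v where z: "z = (u, v)" "u < a" "v < b" "run_coprime m a u" "run_coprime m b v"
        by auto
      obtain x where x: "x < a * b" "[x = u] (mod a)" "[x = v] (mod b)"
        using ex1_implies_ex[OF binary_chinese_remainder_unique_nat[OF assms, of u v]] False by auto
      with z have "x \<in> ?C (a * b)" "z = (x mod a, x mod b)"
        by (auto simp: run_coprime_mult run_coprime_cong[of x u a] run_coprime_cong[of x v b]
            cong_def)
      then show "z \<in> (\<lambda>x. (x mod a, x mod b)) ` ?C (a * b)"
        by (rule rev_image_eqI)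
    qed (use False in \<open>auto simp: run_coprime_mod run_coprime_mult\<close>)
  qed
  then show ?thesis
    unfolding schemmel_eq_card_residues by (simp add: bij_betw_same_card card_cartesian_product)
qed auto

text \<open>Since \<open>a\<close> divides \<open>b\<close>, coprimality to \<open>a * b\<close> is
  coprimality to \<open>b\<close>. The residues modulo \<open>a * b\<close> form \<open>a\<close>
  blocks of length \<open>b\<close>, each contributing the same count.\<close>

lemma schemmel_mult_dvd:
  assumes "a dvd b"
  shows "schemmel m (a * b) = a * schemmel m b"
proof (cases "b = 0")
  case False
  let ?C = "\<lambda>n. {k. k < n \<and> run_coprime m n k}"
  have coprime_iff: "run_coprime m (a * b) k \<longleftrightarrow> run_coprime m b k" for k
    using coprime_divisors[OF dvd_refl assms] by (auto simp: run_coprime_mult run_coprime_def)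
  have "bij_betw (\<lambda>x. (x div b, x mod b)) (?C (a * b)) ({..<a} \<times> ?C b)"
  proof (rule bij_betw_byWitness[where f' = "\<lambda>(q, r). q * b + r"])
    show "(\<lambda>(q, r). q * b + r) ` ({..<a} \<times> ?C b) \<subseteq> ?C (a * b)"
    proof clarsimp
      fix q r assume "q < a" "r < b" "run_coprime m b r"
      have "q * b + r < Suc q * b"
        using \<open>r < b\<close> by simp
      also have "\<dots> \<le> a * b"
        using \<open>q < a\<close> by (intro mult_le_mono1) simp
      finally show "q * b + r < a * b \<and> run_coprime m (a * b) (q * b + r)"
        using \<open>run_coprime m b r\<close>
        by (simp add: coprime_iff run_coprime_cong[of "q * b + r" r b] cong_def)
    qed
  qed (use False in \<open>auto simp: coprime_iff run_coprime_mod less_mult_imp_div_less\<close>)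
  then show ?thesis
    unfolding schemmel_eq_card_residues by (simp add: bij_betw_same_card card_cartesian_product)
qed simp

section \<open>Iterates that reach 1\<close>

definition reaches_one :: "nat \<Rightarrow> nat \<Rightarrow> bool" where
  "reaches_one m n \<longleftrightarrow> (\<exists>k. (schemmel m ^^ k) n = 1)"

lemma funpow_fixpoint: "f x = x \<Longrightarrow> (f ^^ k) x = x"
  by (induction k) auto

lemma reaches_one_0: "\<not> reaches_one m 0"
  by (simp add: reaches_one_def funpow_fixpoint)

lemma reaches_one_1: "reaches_one m 1"
  unfolding reaches_one_def by (rule exI[of _ 0]) simp

lemma reaches_one_schemmel: "reaches_one m (schemmel m n) \<longleftrightarrow> reaches_one m n"
proof
  assume "reaches_one m n"
  then obtain k where "(schemmel m ^^ k) n = 1"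
    by (auto simp: reaches_one_def)
  \<comment> \<open>The same \<open>k\<close> serves, even \<open>k = 0\<close>, because one further
    application fixes 1.\<close>
  then have "(schemmel m ^^ k) (schemmel m n) = 1"
    using schemmel_1 by (metis One_nat_def funpow_swap1)
  then show "reaches_one m (schemmel m n)"
    by (auto simp: reaches_one_def)
next
  assume "reaches_one m (schemmel m n)"
  then obtain k where "(schemmel m ^^ k) (schemmel m n) = 1"
    by (auto simp: reaches_one_def)
  then have "(schemmel m ^^ Suc k) n = 1"
    by (simp add: funpow_Suc_right del: funpow.simps)
  then show "reaches_one m n"
    unfolding reaches_one_def by blast
qed

text \<open>Values above 1 strictly decrease, so the minimum in \<open>R\<close> is attained and
  \<open>LEAST\<close> has its intended meaning.\<close>

lemma H_in_0_1:
  assumes "0 < m"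
  shows "H m n \<in> {0, 1}"
proof -
  have "\<exists>k>0. (schemmel m ^^ k) n \<in> {0, 1}"
  proof (induction n rule: less_induct)
    case (less n)
    show ?case
    proof (cases "1 < n")
      case True
      then obtain k where "(schemmel m ^^ k) (schemmel m n) \<in> {0, 1}"
        using less schemmel_less assms by blast
      then have "(schemmel m ^^ Suc k) n \<in> {0, 1}"
        by (simp add: funpow_Suc_right del: funpow.simps)
      then show ?thesis
        by blast
    next
      case False
      then have "n = 0 \<or> n = Suc 0" by auto
      then show ?thesis
        by (intro exI[of _ 1]) auto
    qed
  qed
  then show ?thesis
    unfolding H_def R_def using LeastI_ex[of "\<lambda>k. 0 < k \<and> (schemmel m ^^ k) n \<in> {0, 1}"] by simp
qed

lemma reaches_one_funpow: "reaches_one m ((schemmel m ^^ k) n) \<longleftrightarrow> reaches_one m n"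
  by (induction k) (simp_all add: reaches_one_schemmel)

text \<open>\<open>H m n\<close> is an iterate of \<open>n\<close>, so it reaches 1 exactly when
  \<open>n\<close> does; of its possible values 0 and 1, the fixed point 0 does not.\<close>

lemma H_eq_0_iff:
  assumes "0 < m"
  shows "H m n = 0 \<longleftrightarrow> \<not> reaches_one m n"
proof -
  have "reaches_one m (H m n) \<longleftrightarrow> reaches_one m n"
    by (simp add: H_def reaches_one_funpow)
  then show ?thesis
    using H_in_0_1[OF assms, of n] reaches_one_0 reaches_one_1 by auto
qed

section \<open>Membership in S through prime factors\<close>

lemma S_iff:
  assumes "0 < m"
  shows "n \<in> S m \<longleftrightarrow> 0 < n \<and> (\<forall>p. prime p \<longrightarrow> p dvd n \<longrightarrow> reaches_one m p)"
  by (auto simp: S_def Q_def H_eq_0_iff[OF assms])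

lemma zero_notin_S: "0 \<notin> S m"
  by (simp add: S_def)

lemma one_in_S: "1 \<in> S m"
  by (auto simp: S_def Q_def)

lemma S_mult_iff: "a * b \<in> S m \<longleftrightarrow> a \<in> S m \<and> b \<in> S m"
  by (auto simp: S_def Q_def prime_dvd_mult_iff)

lemma prime_in_S_iff:
  assumes "0 < m" "prime p"
  shows "p \<in> S m \<longleftrightarrow> reaches_one m p"
  using assms by (auto simp: S_iff prime_gt_0_nat dest: primes_dvd_imp_eq)

text \<open>Adjoining one prime p multiplies the totient by p or by p - m, and the second assumption
  makes these interchangeable for membership. It is restricted to primes dividing \<open>n\<close>
  so that a strong induction can supply it.\<close>

lemma schemmel_in_S_iff:
  assumes "0 < n"
    and "\<And>p. prime p \<Longrightarrow> p dvd n \<Longrightarrow> p - m \<in> S m \<longleftrightarrow> p \<in> S m"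
  shows "schemmel m n \<in> S m \<longleftrightarrow> n \<in> S m"
  using assms
proof (induction n rule: prime_divisors_induct)
  case (factor p n)
  have "schemmel m n \<in> S m \<longleftrightarrow> n \<in> S m"
    using factor by simp
  moreover have "p - m \<in> S m \<longleftrightarrow> p \<in> S m"
    using factor by simp
  moreover have "coprime p n" if "\<not> p dvd n"
    using that factor by (simp add: prime_imp_coprime)
  ultimately show ?case
    using \<open>prime p\<close> by (cases "p dvd n")
      (auto simp: schemmel_mult_dvd schemmel_mult_coprime schemmel_prime S_mult_iff)
qed (use one_in_S in auto)

lemma reaches_one_iff_in_S:
  assumes "0 < m"
  shows "reaches_one m n \<longleftrightarrow> n \<in> S m"
proof (induction n rule: less_induct)
  case (less n)
  consider "n = 0" | "n = 1" | "1 < n"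
    by linarith
  then show ?case
  proof cases
    case 3
    have "p - m \<in> S m \<longleftrightarrow> p \<in> S m" if "prime p" "p dvd n" for p
    proof -
      \<comment> \<open>Strict even for p = n, as m is positive; so the induction hypothesis covers
        prime \<open>n\<close> as well.\<close>
      have "p - m < n"
        using diff_less[OF assms prime_gt_0_nat[OF \<open>prime p\<close>]] dvd_imp_le[OF \<open>p dvd n\<close>] 3
        by linarith
      then have "p - m \<in> S m \<longleftrightarrow> reaches_one m (schemmel m p)"
        using less.IH[of "p - m"] that by (simp add: schemmel_prime)
      also have "\<dots> \<longleftrightarrow> p \<in> S m"
        using that assms by (simp add: reaches_one_schemmel prime_in_S_iff)
      finally show ?thesis .
    qed
    with 3 have "schemmel m n \<in> S m \<longleftrightarrow> n \<in> S m"
      by (intro schemmel_in_S_iff) auto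
    with less.IH[OF schemmel_less[OF assms 3]] show ?thesis
      by (simp add: reaches_one_schemmel)
  qed (use zero_notin_S one_in_S reaches_one_0 reaches_one_1 in auto)
qed

section \<open>Existence and uniqueness for the conditions on T\<close>

lemma T_conditions_S:
  assumes "0 < m"
  shows "T_conditions m (S m)"
  unfolding T_conditions_def
proof (intro conjI allI impI)
  show "S m \<subseteq> {0<..}"
    by (auto simp: S_def)
  show "1 \<in> S m"
    by (rule one_in_S)
next
  fix p :: nat assume "prime p"
  have "p \<in> S m \<longleftrightarrow> p - m \<in> S m"
    using reaches_one_schemmel[of m p] \<open>prime p\<close>
    by (simp add: reaches_one_iff_in_S[OF assms] schemmel_prime)
  \<comment> \<open>Otherwise the truncated difference is 0, which lies outside
    \<open>S m\<close>.\<close>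
  moreover have "m < p" if "p - m \<in> S m"
    using that zero_notin_S[of m] by (cases "m < p") auto
  ultimately show "p \<in> S m \<longleftrightarrow> m < p \<and> p - m \<in> S m"
    by blast
next
  fix x :: nat assume "1 < x \<and> \<not> prime x"
  then obtain a where "1 < x" "a dvd x" "a \<noteq> 1" "a \<noteq> x"
    by (auto simp: prime_nat_iff)
  then obtain b where "x = a * b" "1 < a" "1 < b"
    by (cases "a = 0") (auto elim!: dvdE simp: nat_neq_iff)
  then show "x \<in> S m \<longleftrightarrow> (\<exists>x1\<in>S m. \<exists>x2\<in>S m. 1 < x1 \<and> 1 < x2 \<and> x1 * x2 = x)"
    using S_mult_iff by blast
qed

text \<open>Each condition decides membership of x from smaller numbers: p - m < p as m is positive,
  and in a factorization with both factors above 1 each factor is below x.\<close>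

lemma T_conditions_unique:
  assumes "0 < m" "T_conditions m A" "T_conditions m B"
  shows "A = B"
proof -
  have "x \<in> A \<longleftrightarrow> x \<in> B" for x
  proof (induction x rule: less_induct)
    case (less x)
    consider "x = 0" | "x = 1" | "prime x" | "1 < x" "\<not> prime x"
      by (meson less_one linorder_neqE_nat)
    then show ?case
    proof cases
      case 3
      then have "x - m \<in> A \<longleftrightarrow> x - m \<in> B"
        using assms(1) by (intro less.IH) (simp add: prime_gt_0_nat)
      with 3 assms(2,3) show ?thesis
        by (simp add: T_conditions_def)
    next
      case 4
      have "a \<in> A \<and> b \<in> A \<longleftrightarrow> a \<in> B \<and> b \<in> B" if "1 < a" "1 < b" "a * b = x" for a b
        using less.IH[of a] less.IH[of b] that by auto
      then have "(\<exists>a\<in>A. \<exists>b\<in>A. 1 < a \<and> 1 < b \<and> a * b = x) \<longleftrightarrow>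
          (\<exists>a\<in>B. \<exists>b\<in>B. 1 < a \<and> 1 < b \<and> a * b = x)"
        by blast
      with 4 assms(2,3) show ?thesis
        by (simp add: T_conditions_def)
    qed (use assms(2,3) in \<open>auto simp: T_conditions_def\<close>)
  qed
  then show ?thesis
    by blast
qed

theorem theorem1p2:
  fixes m :: nat
  assumes "0 < m"
  shows "(\<exists>!A. T_conditions m A) \<and> S m = T m"
proof
  show "\<exists>!A. T_conditions m A"
    using T_conditions_S[OF assms] T_conditions_unique[OF assms] by blast
  then show "S m = T m"
    unfolding T_def using T_conditions_S[OF assms] by (rule the1_equality[symmetric])
qed

end
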